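(* Let $m\ge2$ and $n\ge 2$ be integers, and let $\pi=\{R_1(S_1,D_1),\dots,R_L(S_L,D_L)\}$, $L\le m^n$, be a set of connection requests in the AWG-based WDM shuffle-exchange network $\mathcal{S}(m,n)$, where each request $R_j$ asks for a connection from input channel $S_j$ to output channel $D_j$ and is routed along its self-routing path. If $\pi$ is monotonic and concentrated, then $\mathcal{S}(m,n)$ is contention-free for $\pi$: no two distinct requests of $\pi$ use the same wavelength at the same link.
   Context: Notation: $[X]_m$ denotes $X \bmod m$, taken in $\{0,\dots,m-1\}$. Strings $\underline{x_n}\cdots\underline{x_1}$ have digits in $\{0,\dots,m-1\}$ and are compared as $m$-ary integers (with $x_n$ the most significant digit). An $m\times m$ AWG (arrayed waveguide grating) is a passive wavelength router with inputs and outputs $0,\dots,m-1$ and wavelengths $\lambda_0,\dots,\lambda_{m-1}$. A signal entering input $p$ on $\lambda_i$ leaves at output $q'=[i-p]_m$ on $\lambda_i$. The AWG-based shuffle network $\mathcal{W}(m,m^{n-1})$ is built from $m^{n-2}$ AWGs of size $m\times m$, numbered by $a\in\{0,\dots,m^{n-2}-1\}$. It has input ports $(p,a)$, $0\le p\le m-1$, where port $(p,a)$ is linked to input $p$ of AWG $a$. It has output ports $(a,q')$, $0\le q'\le m-1$, where port $(a,q')$ is linked to output $q'$ of AWG $a$. Every port carries the wavelengths $\lambda_0,\dots,\lambda_{m-1}$. An input port $(p,a)$ has the address $\underline{x_n}\,\underline{x_{n-1}}\cdots\underline{x_2}$, where $x_n=p$ and $\underline{x_{n-1}}\cdots\underline{x_2}$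 is the $m$-ary representation of $a$. An input channel (input port, wavelength) $(\underline{x_n}\cdots\underline{x_2},\lambda_i)$ has the field address $\underline{x_n}\cdots\underline{x_2}\,\underline{x_1}$ with $x_1=[i-x_n]_m$. An output port $(a,q')$ has the address $\underline{y_n}\cdots\underline{y_2}$, where $\underline{y_n}\cdots\underline{y_3}$ is the $m$-ary representation of $a$ and $y_2=q'$. An output channel $(\underline{y_n}\cdots\underline{y_2},\lambda_i)$ has the field address $\underline{y_n}\cdots\underline{y_2}\,\underline{y_1}$ with $y_1=[i-y_2]_m$. With this labelling, input channel $\underline{x_n}\,\underline{x_{n-1}}\cdots\underline{x_1}$ is connected to output channel $\underline{x_{n-1}}\cdots\underline{x_1}\,\underline{x_n}$, both on wavelength $\lambda_{[x_n+x_1]_m}$. The network $\mathcal{S}(m,n)$ is the cascade of $n$ copies $\mathcal{W}_0,\dots,\mathcal{W}_{n-1}$ of $\mathcal{W}(m,m^{n-1})$ (shuffle stages), in which every output port of every copy is attached to an $m\times m$ TWC-module. The TWC-module attached to output port $\underline{y_n}\cdots\underline{y_2}$ of $\mathcal{W}_k$ leads to the input port of $\mathcal{W}_{k+1}$ with the same address if $k<n-1$, and to the output port of $\mathcal{S}(m,n)$ with that address (in the output stage) if $k=n-1$. A TWC-module (tunable wavelength converters) can convert each wavelength on its incoming fiber to any wavelength $\lambda_0,\dots,\lambda_{m-1}$ on its outgoing fiber, like an $m\times m$ crossbar. The input channels of $\mathcal{S}(m,n)$ are those of $\mathcal{W}_0$, with the same field addresses. The output channels of $\mathcal{S}(m,n)$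 are addressed in the same way as the input channels of a shuffle stage: $(\underline{d_n}\cdots\underline{d_2},\lambda_i)$ has field address $\underline{d_n}\cdots\underline{d_2}\,\underline{d_1}$ with $d_1=[i-d_n]_m$. Self-routing path of a request $R(S,D)$ with $S=\underline{s_n}\cdots\underline{s_1}$, $D=\underline{d_n}\cdots\underline{d_1}$: for $0\le k\le n-1$ the request enters $\mathcal{W}_k$ at input channel $X_k=\underline{s_{n-k}}\cdots\underline{s_1}\,\underline{d_n}\cdots\underline{d_{n-k+1}}$ (so $X_0=S$) and leaves $\mathcal{W}_k$ at output channel $Y_k=\underline{s_{n-k-1}}\cdots\underline{s_1}\,\underline{d_n}\cdots\underline{d_{n-k+1}}\,\underline{s_{n-k}}$. It finally reaches the output channel $X_n=D$ in the output stage, each passage $Y_k\to X_{k+1}$ being a wavelength conversion in a TWC-module. Contention: two requests are in contention if they use the same wavelength at the same link, i.e. if for some stage they occupy the same wavelength at the same input port of $\mathcal{W}_k$, at the same output port of $\mathcal{W}_k$, or at the same output port of the output stage. Conditions on $\pi$, with the requests indexed so that $S_1<S_2<\cdots<S_L$. Monotonic: $D_1<D_2<\cdots<D_L$ or $D_1>D_2>\cdots>D_L$. Concentrated: any input channel lying between two active input channels is active, where an input channel is active if it equals some $S_j$. *)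

theory Defs
  imports Main
begin

section \<open>Strings of \<open>m\<close>-ary digits\<close>

text \<open>
  The string \<open>x\<^sub>n \<dots> x\<^sub>1\<close> is the list \<open>[x\<^sub>n, \<dots>, x\<^sub>1]\<close>: the most significant digit is the head,
  so \<open>xs ! k\<close> is \<open>x\<^bsub>n-k\<^esub>\<close>.
\<close>

definition residue_mod :: "nat \<Rightarrow> int \<Rightarrow> nat"
  where "residue_mod m x = nat (x mod int m)"

definition digit_strings :: "nat \<Rightarrow> nat \<Rightarrow> nat list set"
  where "digit_strings m l = {xs. length xs = l \<and> set xs \<subseteq> {..<m}}"

definition string_value :: "nat \<Rightarrow> nat list \<Rightarrow> nat"
  where "string_value m xs = horner_sum id m (rev xs)"

definition digits :: "nat \<Rightarrow> nat \<Rightarrow> nat \<Rightarrow> nat list"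
  where "digits m l a = map (\<lambda>i. a div m ^ i mod m) (rev [0..<l])"


section \<open>The shuffle network \<open>\<W>(m, m\<^bsup>n-1\<^esup>)\<close>\<close>

text \<open>
  An input port \<open>(p, a)\<close> is input \<open>p\<close> of AWG \<open>a\<close>, an output port \<open>(a, q)\<close> is output \<open>q\<close> of
  AWG \<open>a\<close>, and a channel is a port together with the index of a wavelength.
\<close>

type_synonym port = "nat \<times> nat"
type_synonym channel = "port \<times> nat"

definition in_ports :: "nat \<Rightarrow> nat \<Rightarrow> port set"
  where "in_ports m n = {..<m} \<times> {..<m ^ (n - 2)}"

definition out_ports :: "nat \<Rightarrow> nat \<Rightarrow> port set"
  where "out_ports m n = {..<m ^ (n - 2)} \<times> {..<m}"

fun in_port_address :: "nat \<Rightarrow> nat \<Rightarrow> port \<Rightarrow> nat list"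
  where "in_port_address m n (p, a) = p # digits m (n - 2) a"

fun out_port_address :: "nat \<Rightarrow> nat \<Rightarrow> port \<Rightarrow> nat list"
  where "out_port_address m n (a, q) = digits m (n - 2) a @ [q]"

fun in_field_address :: "nat \<Rightarrow> nat \<Rightarrow> channel \<Rightarrow> nat list"
  where "in_field_address m n ((p, a), i) =
    in_port_address m n (p, a) @ [residue_mod m (int i - int p)]"

fun out_field_address :: "nat \<Rightarrow> nat \<Rightarrow> channel \<Rightarrow> nat list"
  where "out_field_address m n ((a, q), i) =
    out_port_address m n (a, q) @ [residue_mod m (int i - int q)]"

fun awg_transit :: "nat \<Rightarrow> channel \<Rightarrow> channel"
  where "awg_transit m ((p, a), i) = ((a, residue_mod m (int i - int p)), i)"


section \<open>Self-routing in \<open>\<S>(m, n)\<close>\<close>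

type_synonym request = "nat list \<times> nat list"

definition requests :: "nat \<Rightarrow> nat \<Rightarrow> request set"
  where "requests m n = digit_strings m n \<times> digit_strings m n"

fun route_in :: "nat \<Rightarrow> request \<Rightarrow> nat list"
  where "route_in k (S, D) = drop k S @ take k D"

fun route_out :: "nat \<Rightarrow> request \<Rightarrow> nat list"
  where "route_out k (S, D) = drop (Suc k) S @ take k D @ [S ! k]"

text \<open>
  The ports of the output stage are addressed like the input ports of a shuffle stage, and are
  represented by the same pairs.
\<close>

datatype link =
    Stage_Input nat port
  | Stage_Output nat port
  | Network_Output port

fun occupies :: "nat \<Rightarrow> nat \<Rightarrow> request \<Rightarrow> link \<Rightarrow> nat \<Rightarrow> bool"
  where
    "occupies m n R (Stage_Input k P) i \<longleftrightarrow>
      k < n \<and> P \<in> in_ports m n \<and> i < m \<and> in_field_address m n (P, i) = route_in k R"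
  | "occupies m n R (Stage_Output k P) i \<longleftrightarrow>
      k < n \<and> P \<in> out_ports m n \<and> i < m \<and> out_field_address m n (P, i) = route_out k R"
  | "occupies m n R (Network_Output P) i \<longleftrightarrow>
      P \<in> in_ports m n \<and> i < m \<and> in_field_address m n (P, i) = route_in n R"

definition in_contention :: "nat \<Rightarrow> nat \<Rightarrow> request \<Rightarrow> request \<Rightarrow> bool"
  where "in_contention m n R R' \<longleftrightarrow> (\<exists>l i. occupies m n R l i \<and> occupies m n R' l i)"

definition contention_free :: "nat \<Rightarrow> nat \<Rightarrow> request set \<Rightarrow> bool"
  where "contention_free m n \<pi> \<longleftrightarrow>
    (\<forall>R\<in>\<pi>. \<forall>R'\<in>\<pi>. R \<noteq> R' \<longrightarrow> \<not> in_contention m n R R')"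


section \<open>Conditions on a set of requests\<close>

definition monotonic :: "nat \<Rightarrow> request set \<Rightarrow> bool"
  where "monotonic m \<pi> \<longleftrightarrow>
    (\<exists>R. bij_betw R {1..card \<pi>} \<pi> \<and>
         strict_mono_on {1..card \<pi>} (\<lambda>j. string_value m (fst (R j))) \<and>
         (strict_mono_on {1..card \<pi>} (\<lambda>j. string_value m (snd (R j))) \<or>
          strict_antimono_on {1..card \<pi>} (\<lambda>j. string_value m (snd (R j)))))"

definition active :: "request set \<Rightarrow> nat list \<Rightarrow> bool"
  where "active \<pi> x \<longleftrightarrow> x \<in> fst ` \<pi>"

definition concentrated :: "nat \<Rightarrow> nat \<Rightarrow> request set \<Rightarrow> bool"
  where "concentrated m n \<pi> \<longleftrightarrow>
    (\<forall>s s'. \<forall>x\<in>digit_strings m n.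
       active \<pi> s \<and> active \<pi> s' \<and>
       string_value m s < string_value m x \<and> string_value m x < string_value m s' \<longrightarrow>
       active \<pi> x)"


section \<open>Consistency of the addressing with the hardware\<close>

lemma digits_0: "digits m 0 a = []"
  by (simp add: digits_def)

lemma digits_Suc: "digits m (Suc l) a = digits m l (a div m) @ [a mod m]"
proof -
  have "rev [0..<Suc l] = map Suc (rev [0..<l]) @ [0]"
    by (metis map_Suc_upt rev.simps(2) rev_map upt_conv_Cons zero_less_Suc)
  then show ?thesis
    by (simp add: digits_def div_mult2_eq del: upt_Suc)
qed

lemma length_digits [simp]: "length (digits m l a) = l"
  by (simp add: digits_def)

lemma set_digitsD: "d \<in> set (digits m l a) \<Longrightarrow> m > 0 \<Longrightarrow> d < m"
  by (auto simp: digits_def)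

lemma string_value_digits: "a < m ^ l \<Longrightarrow> string_value m (digits m l a) = a"
  by (induction l arbitrary: a)
    (simp_all add: digits_0 digits_Suc string_value_def less_mult_imp_div_less mult.commute)

lemma digits_string_value:
  "xs \<in> digit_strings m l \<Longrightarrow> string_value m xs < m ^ l \<and> digits m l (string_value m xs) = xs"
proof (induction l arbitrary: xs)
  case 0
  then show ?case by (simp add: digit_strings_def string_value_def digits_0)
next
  case (Suc l)
  then obtain ys d where xs: "xs = ys @ [d]"
    by (metis (mono_tags, lifting) digit_strings_def length_Suc_conv_rev mem_Collect_eq)
  with Suc.prems have ys: "ys \<in> digit_strings m l" and d: "d < m"
    by (auto simp: digit_strings_def)
  have val: "string_value m xs = d + m * string_value m ys"
    by (simp add: xs string_value_def)
  have "Suc (string_value m ys) \<le> m ^ l"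
    using Suc.IH[OF ys] by simp
  then have "m * Suc (string_value m ys) \<le> m * m ^ l"
    by (rule mult_le_mono2)
  with d have "string_value m xs < m ^ Suc l"
    by (simp add: val)
  moreover have "digits m (Suc l) (string_value m xs) = ys @ [d]"
    using Suc.IH[OF ys] d by (simp add: digits_Suc val)
  ultimately show ?case by (simp add: xs)
qed

lemma bij_betw_digits:
  assumes "m > 0"
  shows "bij_betw (digits m l) {..<m ^ l} (digit_strings m l)"
  by (rule bij_betw_byWitness[where f' = "string_value m"])
    (use assms in \<open>auto simp: string_value_digits digits_string_value digit_strings_def
      dest: set_digitsD\<close>)

lemma residue_mod_less: "m > 0 \<Longrightarrow> residue_mod m x < m"
  by (simp add: residue_mod_def nat_less_iff)

lemma residue_mod_diff:
  assumes "i < m"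
  shows "residue_mod m (int p + int (residue_mod m (int i - int p))) = i"
  using assms by (simp add: residue_mod_def mod_add_right_eq)

lemma residue_mod_diff':
  assumes "x < m"
  shows "residue_mod m (int (residue_mod m (int p + int x)) - int p) = x"
  using assms by (simp add: residue_mod_def mod_diff_left_eq)

lemma bij_betw_in_field_address:
  assumes "m > 0" "n \<ge> 2"
  shows "bij_betw (in_field_address m n) (in_ports m n \<times> {..<m}) (digit_strings m n)"
proof (rule bij_betw_byWitness[where f' = "\<lambda>x. ((hd x, string_value m (butlast (tl x))),
    residue_mod m (int (hd x) + int (last x)))"])
  show "\<forall>c\<in>in_ports m n \<times> {..<m}.
      ((hd (in_field_address m n c), string_value m (butlast (tl (in_field_address m n c)))),
       residue_mod m (int (hd (in_field_address m n c)) + int (last (in_field_address m n c)))) = c"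
    by (auto simp: in_ports_def string_value_digits residue_mod_diff)
  show "in_field_address m n ` (in_ports m n \<times> {..<m}) \<subseteq> digit_strings m n"
    using assms by (auto simp: in_ports_def digit_strings_def residue_mod_less
        dest: set_digitsD[OF _ assms(1)])
  have split: "\<exists>a ys b. x = a # ys @ [b] \<and> a < m \<and> ys \<in> digit_strings m (n - 2) \<and> b < m"
    if x: "x \<in> digit_strings m n" for x
  proof -
    obtain a zs where "x = a # zs" "zs \<noteq> []"
      using x assms by (cases x) (fastforce simp: digit_strings_def)+
    moreover obtain ys b where "zs = ys @ [b]"
      using \<open>zs \<noteq> []\<close> by (cases zs rule: rev_cases) auto
    ultimately show ?thesis using x by (auto simp: digit_strings_def)
  qed
  show "\<forall>x\<in>digit_strings m n. in_field_address m n ((hd x, string_value m (butlast (tl x))),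
      residue_mod m (int (hd x) + int (last x))) = x"
    by (auto dest!: split simp: digits_string_value residue_mod_diff')
  show "(\<lambda>x. ((hd x, string_value m (butlast (tl x))),
      residue_mod m (int (hd x) + int (last x)))) ` digit_strings m n \<subseteq> in_ports m n \<times> {..<m}"
    using assms
    by (auto dest!: split simp: digits_string_value residue_mod_less in_ports_def)
qed

lemma out_field_address_awg_transit:
  assumes "p < m" "i < m"
  shows "out_field_address m n (awg_transit m ((p, a), i)) =
    rotate1 (in_field_address m n ((p, a), i))"
proof -
  have "int (residue_mod m (int i - int p)) = (int i - int p) mod int m"
    using assms by (simp add: residue_mod_def)
  then have "residue_mod m (int i - int (residue_mod m (int i - int p))) = p"
    using assms by (simp add: residue_mod_def mod_diff_right_eq)
  then show ?thesis by simp
qed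

lemma bij_betw_awg_transit:
  "bij_betw (awg_transit m) (in_ports m n \<times> {..<m}) (out_ports m n \<times> {..<m})"
proof (rule bij_betw_byWitness[where
    f' = "\<lambda>((a, q), i). ((residue_mod m (int i - int q), a), i)"])
  have inv: "residue_mod m (int i - int (residue_mod m (int i - int p))) = p"
    if "p < m" for p i
    using that by (simp add: residue_mod_def mod_diff_right_eq)
  show "\<forall>c\<in>in_ports m n \<times> {..<m}.
      (\<lambda>((a, q), i). ((residue_mod m (int i - int q), a), i)) (awg_transit m c) = c"
    and "\<forall>c\<in>out_ports m n \<times> {..<m}.
      awg_transit m ((\<lambda>((a, q), i). ((residue_mod m (int i - int q), a), i)) c) = c"
    by (auto simp: in_ports_def out_ports_def inv)
qed (auto simp: in_ports_def out_ports_def residue_mod_less)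

lemma bij_betw_out_field_address:
  assumes "m > 0" "n \<ge> 2"
  shows "bij_betw (out_field_address m n) (out_ports m n \<times> {..<m}) (digit_strings m n)"
proof -
  let ?I = "in_ports m n \<times> {..<m}"
  have "bij_betw rotate1 (digit_strings m n) (digit_strings m n)"
  proof (rule bij_betw_byWitness[where f' = "\<lambda>x. last x # butlast x"])
    show "\<forall>x\<in>digit_strings m n. last (rotate1 x) # butlast (rotate1 x) = x"
    proof
      fix x assume "x \<in> digit_strings m n"
      then show "last (rotate1 x) # butlast (rotate1 x) = x"
        using assms by (cases x) (auto simp: digit_strings_def)
    qed
    show "\<forall>x\<in>digit_strings m n. rotate1 (last x # butlast x) = x"
      using assms by (auto simp: digit_strings_def intro!: append_butlast_last_id)
    show "rotate1 ` digit_strings m n \<subseteq> digit_strings m n"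
      by (auto simp: digit_strings_def)
    show "(\<lambda>x. last x # butlast x) ` digit_strings m n \<subseteq> digit_strings m n"
    proof
      fix y assume "y \<in> (\<lambda>x. last x # butlast x) ` digit_strings m n"
      then obtain x where x: "x \<in> digit_strings m n" and y: "y = last x # butlast x"
        by blast
      from x assms have "x \<noteq> []" by (auto simp: digit_strings_def)
      with x assms show "y \<in> digit_strings m n"
        by (cases x rule: rev_cases) (auto simp: digit_strings_def y)
    qed
  qed
  then have "bij_betw (rotate1 \<circ> in_field_address m n) ?I (digit_strings m n)"
    using bij_betw_in_field_address[OF assms] bij_betw_trans by blast
  then have "bij_betw (out_field_address m n \<circ> awg_transit m) ?I (digit_strings m n)"
    by (rule bij_betw_cong[THEN iffD1, rotated])
      (auto simp: in_ports_def out_field_address_awg_transit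
        simp del: out_field_address.simps awg_transit.simps in_field_address.simps)
  then show ?thesis
    using bij_betw_comp_iff[OF bij_betw_awg_transit] by blast
qed

lemma route_in_0: "R \<in> requests m n \<Longrightarrow> route_in 0 R = fst R"
  by (cases R) simp

lemma route_in_n: "R \<in> requests m n \<Longrightarrow> route_in n R = snd R"
  by (cases R) (simp add: requests_def digit_strings_def)

lemma route_out_eq_rotate1:
  assumes "R \<in> requests m n" "k < n"
  shows "route_out k R = rotate1 (route_in k R)"
  using assms
  by (cases R) (simp add: requests_def digit_strings_def flip: Cons_nth_drop_Suc)

text \<open>A TWC-module can perform the passage, since the port address does not change:\<close>

lemma butlast_route_out:
  assumes "R \<in> requests m n" "k < n"
  shows "butlast (route_out k R) = butlast (route_in (Suc k) R)"
  using assms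
  by (cases R) (simp add: requests_def digit_strings_def take_Suc_conv_app_nth butlast_append)

end

(* Two requests that meet after k stages have sources that are congruent modulo m^(n-k) and
   destinations with the same first k digits, so the sources are at least m^(n-k) apart and the
   destinations less than m^(n-k) apart. But the sources of a concentrated set have no gaps, while
   the destinations of a monotonic set are distinct, so the distance of the sources is at most
   the number of steps from one request to the other, which is at most the distance of the
   destinations. *)

theory Submission imports Defs begin

lemma string_value_append:
  "string_value m (xs @ ys) = string_value m xs * m ^ length ys + string_value m ys"
  by (simp add: string_value_def horner_sum_append mult.commute)

lemma string_value_less: "xs \<in> digit_strings m l \<Longrightarrow> string_value m xs < m ^ l"
  by (simp add: digits_string_value)

text \<open>Equal last \<open>n - k\<close> digits make the two values congruent modulo
  \<open>m ^ (n - k)\<close>, so their positive difference is at least one full modulus.\<close>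

lemma string_value_common_suffix_distance:
  assumes "drop k xs = drop k ys" "length xs = n" "string_value m xs < string_value m ys"
  shows "string_value m xs + m ^ (n - k) \<le> string_value m ys"
proof -
  define a where "a zs = string_value m (take k zs)" for zs
  define r where "r = string_value m (drop k xs)"
  have x: "string_value m xs = a xs * m ^ (n - k) + r"
    using string_value_append[of m "take k xs" "drop k xs"] assms(2) by (simp add: a_def r_def)
  \<comment> \<open>The exponent is the length of \<open>drop k ys\<close>, which is
    \<open>n - k\<close> because this suffix is shared with \<open>xs\<close>.\<close>
  have y: "string_value m ys = a ys * m ^ (n - k) + r"
    using string_value_append[of m "take k ys" "drop k ys"] assms(1,2)
    by (simp add: a_def r_def) (metis length_drop)
  from assms(3) have "a xs * m ^ (n - k) < a ys * m ^ (n - k)"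
    by (simp add: x y)
  then have "Suc (a xs) * m ^ (n - k) \<le> a ys * m ^ (n - k)"
    by (intro mult_le_mono1) (auto simp: mult_less_cancel2)
  then show ?thesis by (simp add: x y)
qed

text \<open>The common leading digits contribute equally, and the remaining \<open>n - k\<close>
  digits have a value below \<open>m ^ (n - k)\<close>.\<close>

lemma string_value_common_prefix_distance:
  assumes "take k xs = take k ys" "xs \<in> digit_strings m n" "ys \<in> digit_strings m n"
  shows "string_value m xs < string_value m ys + m ^ (n - k)"
proof -
  have "drop k xs \<in> digit_strings m (n - k)"
    using assms(2) by (auto simp: digit_strings_def dest: in_set_dropD)
  then have "string_value m (drop k xs) < m ^ (n - k)"
    by (rule string_value_less)
  moreover have "string_value m zs =
      string_value m (take k zs) * m ^ (n - k) + string_value m (drop k zs)"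
    if "zs \<in> digit_strings m n" for zs
    using string_value_append[of m "take k zs" "drop k zs"] that by (simp add: digit_strings_def)
  ultimately show ?thesis
    using assms by simp
qed

lemma route_in_eqD:
  assumes "route_in k (S, D) = route_in k (S', D')" "length S = length S'"
  shows "drop k S = drop k S' \<and> take k D = take k D'"
  using assms by simp

text \<open>Rotation of strings is injective, so a clash at the output of a stage is already a clash
  at its input.\<close>

lemma route_out_eqD:
  assumes "route_out k R = route_out k R'" "R \<in> requests m n" "R' \<in> requests m n" "k < n"
  shows "route_in k R = route_in k R'"
  using assms by (auto simp: route_out_eq_rotate1 dest: injD[OF inj_rotate1])

text \<open>A channel has only one field address, so requests sharing it have the same routing
  string. The output stage is the case \<open>k = n\<close>.\<close>

lemma in_contentionD:
  assumes "in_contention m n R R'" "R \<in> requests m n" "R' \<in> requests m n"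
  shows "\<exists>k. route_in k R = route_in k R'"
proof -
  from assms(1) obtain l i where "occupies m n R l i" "occupies m n R' l i"
    by (auto simp: in_contention_def)
  then show ?thesis
    using route_out_eqD[OF _ assms(2,3)]
    by (cases l) (metis occupies.simps)+
qed

text \<open>Counting: \<open>f\<close> maps the \<open>j - i + 1\<close> indices injectively into
  the interval from \<open>f i\<close> to \<open>f j\<close>.\<close>

lemma strict_mono_on_distance:
  fixes f :: "nat \<Rightarrow> nat"
  assumes "strict_mono_on {a..b} f" "i \<in> {a..b}" "j \<in> {a..b}" "i \<le> j"
  shows "f i + (j - i) \<le> f j"
proof -
  have mono: "strict_mono_on {i..j} f"
    using assms by (intro monotone_on_subset[OF assms(1)]) auto
  then have "f ` {i..j} \<subseteq> {f i..f j}"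
    using \<open>i \<le> j\<close> by (auto intro!: strict_mono_on_leD[OF mono])
  moreover have "card (f ` {i..j}) = Suc j - i"
    by (simp add: card_image strict_mono_on_imp_inj_on[OF mono])
  \<comment> \<open>The left side is positive, so the truncated subtraction on the right is a
    genuine one.\<close>
  ultimately have "Suc j - i \<le> Suc (f j) - f i"
    by (metis card_atLeastAtMost card_mono finite_atLeastAtMost)
  then show ?thesis using \<open>i \<le> j\<close> by simp
qed

lemma strict_antimono_on_distance:
  fixes f :: "nat \<Rightarrow> nat"
  assumes "strict_antimono_on {a..b} f" "i \<in> {a..b}" "j \<in> {a..b}" "i \<le> j"
  shows "f j + (j - i) \<le> f i"
proof -
  have less: "f y < f x" if "x \<in> {i..j}" "y \<in> {i..j}" "x < y" for x y
    using assms that by (auto simp: monotone_on_def)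
  then have "f ` {i..j} \<subseteq> {f j..f i}"
    using \<open>i \<le> j\<close> by (fastforce simp: le_less)
  moreover have "inj_on f {i..j}"
    using less by (intro linorder_inj_onI) fastforce+
  then have "card (f ` {i..j}) = Suc j - i"
    by (simp add: card_image)
  ultimately have "Suc j - i \<le> Suc (f i) - f j"
    by (metis card_atLeastAtMost card_mono finite_atLeastAtMost)
  then show ?thesis using \<open>i \<le> j\<close> by simp
qed

text \<open>Every value between the two source values is itself the value of a source with index in
  \<open>{i..j}\<close>, so there are at most \<open>j - i + 1\<close> such values.\<close>

lemma concentrated_source_distance:
  assumes "concentrated m n \<pi>" "\<pi> \<subseteq> requests m n"
    and bij: "bij_betw R {1..L} \<pi>"
    and mono: "strict_mono_on {1..L} (\<lambda>j. string_value m (fst (R j)))"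
    and ij: "i \<in> {1..L}" "j \<in> {1..L}" "i \<le> j"
  shows "string_value m (fst (R j)) \<le> string_value m (fst (R i)) + (j - i)"
proof -
  let ?s = "\<lambda>j. string_value m (fst (R j))"
  have "v \<in> ?s ` {i..j}" if v: "v \<in> {?s i..?s j}" for v
  \<comment> \<open>Concentration speaks only of channels strictly between active ones.\<close>
  proof (cases "v = ?s i \<or> v = ?s j")
    case True
    then show ?thesis using \<open>i \<le> j\<close> by auto
  next
    case False
    then have less: "?s i < v" "v < ?s j" using v by auto
    have R: "R l \<in> \<pi>" if "l \<in> {1..L}" for l
      using bij_betwE[OF bij] that by blast
    then have "fst (R j) \<in> digit_strings m n"
      using ij(2) assms(2) by (fastforce simp: requests_def)
    then have "v < m ^ n" using string_value_less less(2) less_trans by blast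
    then have x: "string_value m (digits m n v) = v"
      by (rule string_value_digits)
    \<comment> \<open>With \<open>m = 0\<close>, the bound on \<open>v\<close> would force
      \<open>n = 0\<close>; the source is then empty and has value 0, which cannot exceed
      \<open>v\<close>.\<close>
    have "m > 0" using \<open>v < m ^ n\<close> \<open>fst (R j) \<in> digit_strings m n\<close> less
      by (cases n) (auto simp: digit_strings_def string_value_def intro: Nat.gr0I)
    then have "digits m n v \<in> digit_strings m n"
      by (auto simp: digit_strings_def dest: set_digitsD)
    moreover have "active \<pi> (fst (R i))" "active \<pi> (fst (R j))"
      using R ij by (auto simp: active_def)
    ultimately have "active \<pi> (digits m n v)"
      using assms(1) less unfolding concentrated_def x by (metis x)
    then obtain l where l: "l \<in> {1..L}" "fst (R l) = digits m n v"
      using bij_betw_imp_surj_on[OF bij] by (auto simp: active_def)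
    then have "?s l = v" using x by simp
    moreover from this have "i < l" "l < j"
      using strict_mono_on_less[OF mono] less ij l(1) by blast+
    ultimately show ?thesis by force
  qed
  then have "{?s i..?s j} \<subseteq> ?s ` {i..j}" by blast
  then have "card {?s i..?s j} \<le> card {i..j}"
    by (rule surj_card_le[rotated]) simp
  then show ?thesis using \<open>i \<le> j\<close> by simp
qed

theorem theorem1:
  fixes m n :: nat and \<pi> :: "request set"
  assumes "m \<ge> 2" and "n \<ge> 2"
    and "\<pi> \<subseteq> requests m n" and "card \<pi> \<le> m ^ n"
    and "monotonic m \<pi>" and "concentrated m n \<pi>"
  shows "contention_free m n \<pi>"
proof -
  define L where "L = card \<pi>"
  obtain R where bij: "bij_betw R {1..L} \<pi>"
    and mono: "strict_mono_on {1..L} (\<lambda>j. string_value m (fst (R j)))"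
    and mono': "strict_mono_on {1..L} (\<lambda>j. string_value m (snd (R j))) \<or>
      strict_antimono_on {1..L} (\<lambda>j. string_value m (snd (R j)))"
    using assms(5) by (auto simp: monotonic_def L_def)
  have R: "fst (R j) \<in> digit_strings m n" "snd (R j) \<in> digit_strings m n" if "j \<in> {1..L}" for j
    using bij_betwE[OF bij] that assms(3) by (fastforce simp: requests_def)+
  \<comment> \<open>Any \<open>k\<close> is allowed: for \<open>k \<ge> n\<close> the truncated
    exponent \<open>n - k\<close> is 0 and the distance bound becomes 1.\<close>
  have distinct: "route_in k (R i) \<noteq> route_in k (R j)"
    if ij: "i \<in> {1..L}" "j \<in> {1..L}" "i < j" for i j k
  proof
    let ?s = "\<lambda>j. string_value m (fst (R j))"
    let ?d = "\<lambda>j. string_value m (snd (R j))"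
    assume "route_in k (R i) = route_in k (R j)"
    then have eq: "drop k (fst (R i)) = drop k (fst (R j))"
        "take k (snd (R i)) = take k (snd (R j))"
      using route_in_eqD[of k "fst (R i)" "snd (R i)" "fst (R j)" "snd (R j)"]
        R(1)[OF ij(1)] R(1)[OF ij(2)] by (auto simp: digit_strings_def)
    have "?s i < ?s j"
      using strict_mono_onD[OF mono] ij by blast
    then have "?s i + m ^ (n - k) \<le> ?s j"
      using string_value_common_suffix_distance[OF eq(1)] R(1)[OF ij(1)]
      by (simp add: digit_strings_def)
    also have "\<dots> \<le> ?s i + (j - i)"
      using concentrated_source_distance[OF assms(6,3) bij mono] ij by simp
    finally have "m ^ (n - k) \<le> j - i" by simp
    \<comment> \<open>Both directions are needed, since the destinations may increase or decrease
      with the index.\<close>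
    moreover have "?d i < ?d j + m ^ (n - k)" "?d j < ?d i + m ^ (n - k)"
      using string_value_common_prefix_distance eq(2) R(2) ij by metis+
    moreover have "?d i + (j - i) \<le> ?d j \<or> ?d j + (j - i) \<le> ?d i"
      using mono' strict_mono_on_distance strict_antimono_on_distance ij less_imp_le by metis
    ultimately show False by linarith
  qed
  show ?thesis
    unfolding contention_free_def
  proof (intro ballI impI notI)
    fix Q Q' assume Q: "Q \<in> \<pi>" "Q' \<in> \<pi>" "Q \<noteq> Q'" "in_contention m n Q Q'"
    then obtain k where "route_in k Q = route_in k Q'"
      using in_contentionD assms(3) by blast
    moreover obtain i j where "i \<in> {1..L}" "j \<in> {1..L}" "Q = R i" "Q' = R j"
      using Q bij_betw_imp_surj_on[OF bij] by blast
    \<comment> \<open>Distinct requests have distinct indices, and \<open>distinct\<close> applies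
      with the smaller one first.\<close>
    ultimately show False
      using distinct \<open>Q \<noteq> Q'\<close> by (metis nat_neq_iff)
  qed
qed

end
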